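(* Let $\mathcal{H}$ be a complex Hilbert space, let $T\in\mathcal{L}^h$ have closed range with positive orthogonal decomposition $T=T_1-T_2$, and let $T=U-V$ be a proper splitting of $T$ with $U\in\mathcal{L}^h$ such that the positive orthogonal decomposition $U=U_1-U_2$ of $U$ satisfies $\mathcal{R}(U_i)=\mathcal{R}(T_i)$ for $i=1,2$. If in addition $U^\dagger T\in\mathcal{L}^h$, then the proper splitting $T=U-V$ converges if and only if $\rho(U^\dagger V)=\max\{\|U_1^\dagger V\|,\|U_2^\dagger V\|\}<1$.
   Context: $\mathcal{L}(\mathcal{H})$ is the algebra of bounded linear operators on $\mathcal{H}$; $\mathcal{L}^h$ and $\mathcal{L}^+$ are the sets of selfadjoint and positive (semidefinite) operators in it; $\mathcal{R}(\cdot)$, $\mathcal{N}(\cdot)$ denote range and nullspace; $\rho(\cdot)$ is the spectral radius; $A^\dagger$ is the Moore-Penrose inverse of a closed range operator $A$. A proper splitting of $T$ is a decomposition $T=U-V$ with $U,V\in\mathcal{L}(\mathcal{H})$, $\mathcal{R}(U)=\mathcal{R}(T)$ and $\mathcal{N}(U)=\mathcal{N}(T)$; it is said to converge if $\rho(U^\dagger V)<1$ (equivalently, if for every solvable equation $TX=S$ the iteration $X^{i+1}=U^\dagger VX^i+U^\dagger S$ converges for every initial $X^0\in\mathcal{L}(\mathcal{H})$). The positive orthogonal decomposition of $A\in\mathcal{L}^h$ is the unique decomposition $A=A_1-A_2$ with $A_1,A_2\in\mathcal{L}^+$ and $\overline{\mathcal{R}(A_1)}\oplus\overline{\mathcal{R}(A_2)}=\overline{\mathcal{R}(A)}$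 (orthogonal sum); explicitly $A_1=\frac{|A|+A}{2}$, $A_2=\frac{|A|-A}{2}$. If $\mathcal{R}(A)$ is closed then so are $\mathcal{R}(A_1)$ and $\mathcal{R}(A_2)$. *)

theory Defs
  imports "HOL-Analysis.Analysis"
begin

(* The real inner product of the library is tied to the complex one by
   inner x y = Re (cinner x y); positive definiteness and the norm induced by
   cinner are therefore inherited from real_inner.  The complex inner product
   is linear in its first argument. *)
class complex_inner = real_inner +
  fixes scaleC :: "complex \<Rightarrow> 'a \<Rightarrow> 'a" (infixr "*\<^sub>C" 75)
    and cinner :: "'a \<Rightarrow> 'a \<Rightarrow> complex"
  assumes scaleC_add_right: "c *\<^sub>C (x + y) = c *\<^sub>C x + c *\<^sub>C y"
    and scaleC_add_left: "(c + d) *\<^sub>C x = c *\<^sub>C x + d *\<^sub>C x"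
    and scaleC_scaleC: "c *\<^sub>C (d *\<^sub>C x) = (c * d) *\<^sub>C x"
    and scaleR_scaleC: "r *\<^sub>R x = complex_of_real r *\<^sub>C x"
    and cinner_commute: "cinner x y = cnj (cinner y x)"
    and cinner_add_left: "cinner (x + y) z = cinner x z + cinner y z"
    and cinner_scaleC_left: "cinner (c *\<^sub>C x) y = c * cinner x y"
    and inner_eq_Re_cinner: "inner x y = Re (cinner x y)"

class chilbert_space = complex_inner + complete_space

definition bounded_clinear :: "('a::chilbert_space \<Rightarrow> 'a) \<Rightarrow> bool" where
  "bounded_clinear A \<longleftrightarrow> bounded_linear A \<and> (\<forall>c x. A (c *\<^sub>C x) = c *\<^sub>C A x)"

definition selfadjoint :: "('a::chilbert_space \<Rightarrow> 'a) \<Rightarrow> bool" where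
  "selfadjoint A \<longleftrightarrow> bounded_clinear A \<and> (\<forall>x y. cinner (A x) y = cinner x (A y))"

definition positive_op :: "('a::chilbert_space \<Rightarrow> 'a) \<Rightarrow> bool" where
  "positive_op A \<longleftrightarrow> bounded_clinear A \<and> (\<forall>x. cinner (A x) x \<in> \<real>\<^sub>\<ge>\<^sub>0)"

definition nullspace :: "('a::chilbert_space \<Rightarrow> 'a) \<Rightarrow> 'a set" where
  "nullspace A = {x. A x = 0}"

definition is_pos_orth_decomp ::
    "('a::chilbert_space \<Rightarrow> 'a) \<Rightarrow> ('a \<Rightarrow> 'a) \<Rightarrow> ('a \<Rightarrow> 'a) \<Rightarrow> bool" where
  "is_pos_orth_decomp A A1 A2 \<longleftrightarrow>
     positive_op A1 \<and> positive_op A2 \<and> A = (\<lambda>x. A1 x - A2 x) \<and>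
     (\<forall>x \<in> closure (range A1). \<forall>y \<in> closure (range A2). cinner x y = 0) \<and>
     {x + y | x y. x \<in> closure (range A1) \<and> y \<in> closure (range A2)} = closure (range A)"

definition is_moore_penrose :: "('a::chilbert_space \<Rightarrow> 'a) \<Rightarrow> ('a \<Rightarrow> 'a) \<Rightarrow> bool" where
  "is_moore_penrose A X \<longleftrightarrow>
     bounded_clinear X \<and> A \<circ> X \<circ> A = A \<and> X \<circ> A \<circ> X = X \<and>
     selfadjoint (A \<circ> X) \<and> selfadjoint (X \<circ> A)"

(* A bounded operator whose range is not closed has no bounded solution of the
   Penrose equations; moore_penrose is unspecified there. *)
definition moore_penrose :: "('a::chilbert_space \<Rightarrow> 'a) \<Rightarrow> ('a \<Rightarrow> 'a)" where
  "moore_penrose A = (THE X. is_moore_penrose A X)"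

definition spectrum :: "('a::chilbert_space \<Rightarrow> 'a) \<Rightarrow> complex set" where
  "spectrum A =
     {z. \<not> (\<exists>B. bounded_clinear B \<and>
              B \<circ> (\<lambda>x. A x - z *\<^sub>C x) = id \<and> (\<lambda>x. A x - z *\<^sub>C x) \<circ> B = id)}"

(* Inserting 0 only matters on the zero space, where the spectrum is empty; it
   makes the supremum one over nonnegative reals, so the spectral radius is 0 there. *)
definition spectral_radius :: "('a::chilbert_space \<Rightarrow> 'a) \<Rightarrow> real" where
  "spectral_radius A = Sup (insert 0 (cmod ` spectrum A))"

definition proper_splitting ::
    "('a::chilbert_space \<Rightarrow> 'a) \<Rightarrow> ('a \<Rightarrow> 'a) \<Rightarrow> ('a \<Rightarrow> 'a) \<Rightarrow> bool" where
  "proper_splitting T U V \<longleftrightarrow>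
     bounded_clinear U \<and> bounded_clinear V \<and> T = (\<lambda>x. U x - V x) \<and>
     range U = range T \<and> nullspace U = nullspace T"

definition splitting_converges ::
    "('a::chilbert_space \<Rightarrow> 'a) \<Rightarrow> ('a \<Rightarrow> 'a) \<Rightarrow> bool" where
  "splitting_converges U V \<longleftrightarrow> spectral_radius (moore_penrose U \<circ> V) < 1"

end

theory Submission
  imports Defs
begin

text \<open>The operator \<open>U\<^sup>\<dagger>V = U\<^sup>\<dagger>U - U\<^sup>\<dagger>T\<close> is selfadjoint, so its spectral radius is its norm.
  Both decompositions live on the same orthogonal sum \<open>R(U\<^sub>1) \<oplus> R(U\<^sub>2)\<close>, hence
  \<open>U\<^sup>\<dagger> = U\<^sub>1\<^sup>\<dagger> - U\<^sub>2\<^sup>\<dagger>\<close> and \<open>U\<^sup>\<dagger>V\<close> is block diagonal with blocks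
  \<open>U\<^sub>1\<^sup>\<dagger>V\<close> and \<open>-U\<^sub>2\<^sup>\<dagger>V\<close>, whose norm is the maximum of the block norms. The equality
  \<open>\<rho>(U\<^sup>\<dagger>V) = max {\<parallel>U\<^sub>1\<^sup>\<dagger>V\<parallel>, \<parallel>U\<^sub>2\<^sup>\<dagger>V\<parallel>}\<close> therefore holds whether or not the splitting
  converges.\<close>

section \<open>Orthogonal projection and automatic boundedness in Hilbert space\<close>

text \<open>The parallelogram law makes a distance-minimizing sequence in \<open>M\<close> Cauchy.
  Its limit is a nearest point, and moving it along \<open>v\<close> cannot decrease the distance,
  which forces orthogonality.\<close>

lemma orthogonal_projection_exists:
  fixes M :: "'a::{real_inner, complete_space} set"
  assumes M: "subspace M" and cl: "closed M"
  shows "\<exists>m\<in>M. \<forall>v\<in>M. inner (x - m) v = 0"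
proof -
  define d where "d = (INF v\<in>M. (norm (x - v))\<^sup>2)"
  have bdd: "bdd_below ((\<lambda>v. (norm (x - v))\<^sup>2) ` M)"
    by (rule bdd_belowI[of _ 0]) auto
  have ne: "M \<noteq> {}" using subspace_0[OF M] by auto
  have d_le: "d \<le> (norm (x - v))\<^sup>2" if "v \<in> M" for v
    unfolding d_def by (rule cINF_lower[OF bdd that])
  have "\<exists>v\<in>M. (norm (x - v))\<^sup>2 < d + inverse (real (Suc n))" for n
    using cINF_less_iff[OF ne bdd, of "d + inverse (real (Suc n))"]
    by (auto simp: d_def[symmetric])
  then obtain y where yM: "\<And>n. y n \<in> M"
    and y: "\<And>n. (norm (x - y n))\<^sup>2 < d + inverse (real (Suc n))"
    by metis
  have diff: "(norm (y m - y n))\<^sup>2 \<le> 2 * inverse (real (Suc m)) + 2 * inverse (real (Suc n))" for m n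
  proof -
    \<comment> \<open>The midpoint stays in \<open>M\<close>, so its squared distance to
      \<open>x\<close> is at least \<open>d\<close>. In the parallelogram law the multiples of
      \<open>d\<close> then cancel and only the errors remain.\<close>
    have "(1/2) *\<^sub>R (y m + y n) \<in> M"
      using M yM by (simp add: subspace_add subspace_scale)
    then have "d \<le> (norm (x - (1/2) *\<^sub>R (y m + y n)))\<^sup>2" by (rule d_le)
    moreover have "(norm (y m - y n))\<^sup>2 = 2 * (norm (x - y m))\<^sup>2 + 2 * (norm (x - y n))\<^sup>2
        - 4 * (norm (x - (1/2) *\<^sub>R (y m + y n)))\<^sup>2"
      unfolding power2_norm_eq_inner
      by (simp add: inner_diff_left inner_diff_right inner_add_left inner_add_right
          inner_commute[of x "y m"] inner_commute[of x "y n"] inner_commute[of "y n" "y m"] algebra_simps)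
    ultimately show ?thesis using y[of m] y[of n] by linarith
  qed
  have "Cauchy y"
  proof (rule metric_CauchyI)
    fix e :: real assume e: "e > 0"
    \<comment> \<open>\<open>diff\<close> contributes two terms, each at most twice this reciprocal,
      hence the factor 4.\<close>
    obtain N where N: "inverse (real (Suc N)) < e\<^sup>2 / 4"
      using reals_Archimedean[of "e\<^sup>2 / 4"] e by auto
    show "\<exists>N. \<forall>m\<ge>N. \<forall>n\<ge>N. dist (y m) (y n) < e"
    proof (intro exI allI impI)
      fix m n assume mn: "N \<le> m" "N \<le> n"
      have "inverse (real (Suc m)) \<le> inverse (real (Suc N))"
        "inverse (real (Suc n)) \<le> inverse (real (Suc N))"
        using mn by (auto simp: field_simps)
      then have "(norm (y m - y n))\<^sup>2 < e\<^sup>2" using diff[of m n] N by linarith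
      then show "dist (y m) (y n) < e"
        using e by (simp add: dist_norm power2_less_imp_less)
    qed
  qed
  then obtain m where lim: "y \<longlonglongrightarrow> m" by (metis Cauchy_convergent convergent_def)
  have mM: "m \<in> M" using closed_sequentially[OF cl] yM lim by blast
  have "(\<lambda>n. (norm (x - y n))\<^sup>2) \<longlonglongrightarrow> (norm (x - m))\<^sup>2"
    by (intro tendsto_intros lim)
  moreover have "(\<lambda>n. d + inverse (real (Suc n))) \<longlonglongrightarrow> d + 0"
    by (intro tendsto_intros LIMSEQ_inverse_real_of_nat)
  ultimately have m_le: "(norm (x - m))\<^sup>2 \<le> d"
    using y LIMSEQ_le[of _ "(norm (x - m))\<^sup>2" _ "d + 0"] by (simp add: less_imp_le)
  have "inner (x - m) v = 0" if v: "v \<in> M" for v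
  proof (cases "v = 0")
    case False
    \<comment> \<open>This \<open>t\<close> minimizes the quadratic giving the squared norm of
      \<open>x - m - t v\<close>.\<close>
    define t where "t = inner (x - m) v / inner v v"
    have vv: "inner v v > 0" using False by simp
    have "m + t *\<^sub>R v \<in> M" using M mM v by (simp add: subspace_add subspace_scale)
    then have "(norm (x - m))\<^sup>2 \<le> (norm ((x - m) - t *\<^sub>R v))\<^sup>2"
      using d_le m_le by (metis diff_diff_add order_trans)
    also have "\<dots> = (norm (x - m))\<^sup>2 - 2 * t * inner (x - m) v + t\<^sup>2 * inner v v"
      unfolding power2_norm_eq_inner
      by (simp add: inner_diff_left[of "x - m"] inner_diff_right[of _ "x - m"]
          inner_commute[of v "x - m"] power2_eq_square right_diff_distrib)
    also have "\<dots> = (norm (x - m))\<^sup>2 - (inner (x - m) v)\<^sup>2 / inner v v"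
      using vv unfolding t_def by (simp add: power2_eq_square field_simps)
    finally have "(inner (x - m) v)\<^sup>2 / inner v v \<le> 0" by simp
    then show ?thesis using vv by (simp add: divide_le_0_iff)
  qed simp
  then show ?thesis using mM by blast
qed

text \<open>Symmetry moves \<open>X\<close> to the other argument, so each set \<open>E n\<close> is
  an intersection of closed half-spaces, and closedness does not presuppose continuity of
  \<open>X\<close>. By Baire some \<open>E n\<close> contains a ball, and a bound on a ball scales
  to a bound everywhere.\<close>

theorem Hellinger_Toeplitz:
  fixes X :: "'a::{real_inner, complete_space} \<Rightarrow> 'a"
  assumes lin: "linear X" and sym: "\<And>x y. inner (X x) y = inner x (X y)"
  shows "bounded_linear X"
proof -
  interpret linear X by fact
  define E where "E n = {x. norm (X x) \<le> real n}" for n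
  have E_eq: "E n = (\<Inter>y. {x. inner x (X y) \<le> real n * norm y})" for n
  proof (intro set_eqI iffI)
    fix x assume "x \<in> E n"
    then have "norm (X x) * norm y \<le> real n * norm y" for y
      by (simp add: E_def mult_right_mono)
    then have "inner (X x) y \<le> real n * norm y" for y
      by (meson norm_cauchy_schwarz order_trans)
    then show "x \<in> (\<Inter>y. {x. inner x (X y) \<le> real n * norm y})" by (simp add: sym)
  next
    fix x assume "x \<in> (\<Inter>y. {x. inner x (X y) \<le> real n * norm y})"
    then have "inner (X x) (X x) \<le> real n * norm (X x)" by (auto simp: sym)
    then have "norm (X x) * norm (X x) \<le> real n * norm (X x)"
      by (simp flip: power2_norm_eq_inner add: power2_eq_square)
    then show "x \<in> E n"
      by (cases "X x = 0") (auto simp: E_def)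
  qed
  have clE: "closed (E n)" for n
    unfolding E_eq by (intro closed_INT ballI closed_Collect_le continuous_intros)
  have "\<exists>n. interior (E n) \<noteq> {}"
  proof (rule ccontr)
    assume "\<not> ?thesis"
    then have "\<And>T. T \<in> range E \<Longrightarrow> closedin euclidean T \<and> euclidean interior_of T = {}"
      using clE by auto
    then have "euclidean interior_of (\<Union>(range E)) = {}"
      by (intro Baire_category_alt disjI1 completely_metrizable_space_euclidean) auto
    moreover have "\<Union>(range E) = UNIV"
      using real_arch_simple by (auto simp: E_def)
    ultimately show False by simp
  qed
  then obtain n a where "a \<in> interior (E n)" by blast
  then obtain r where r: "r > 0" and ball: "cball a r \<subseteq> E n"
    by (meson mem_interior_cball)
  \<comment> \<open>A short vector is the difference of the two points \<open>a + x\<close> and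
    \<open>a\<close> of the ball, each with image of norm at most \<open>n\<close>.\<close>
  have small: "norm (X x) \<le> 2 * real n" if "norm x \<le> r" for x
  proof -
    have "a + x \<in> E n" "a \<in> E n" using ball that r by (auto simp: subset_iff dist_norm)
    then have "norm (X (a + x) - X a) \<le> 2 * real n"
      unfolding E_def using norm_triangle_ineq4[of "X (a + x)" "X a"] by auto
    then show ?thesis by (simp add: add)
  qed
  have "norm (X x) \<le> norm x * (2 * real n / r)" for x
  proof (cases "x = 0")
    case False
    have "norm (X ((r / norm x) *\<^sub>R x)) \<le> 2 * real n"
      using False r by (intro small) simp
    then show ?thesis
      using False r by (simp add: scale field_simps)
  qed (simp add: zero)
  then show ?thesis using bounded_linear_intro[of X] add scale by blast
qed

section \<open>Complex inner product and selfadjoint operators\<close>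

lemma scaleC_diff_right: "c *\<^sub>C (x - y) = c *\<^sub>C x - c *\<^sub>C (y::'a::complex_inner)"
  using scaleC_add_right[of c "x - y" y] by simp

lemma scaleC_one [simp]: "1 *\<^sub>C (x::'a::complex_inner) = x"
  using scaleR_scaleC[of 1 x] by simp

lemma cinner_scaleC_right: "cinner x (c *\<^sub>C (y::'a::complex_inner)) = cnj c * cinner x y"
  by (metis cinner_commute cinner_scaleC_left complex_cnj_mult)

lemma cinner_add_right: "cinner x (y + z) = cinner x y + cinner x (z::'a::complex_inner)"
  by (metis cinner_commute cinner_add_left complex_cnj_add)

lemma cinner_conv_inner:
  "cinner x (y::'a::complex_inner) = Complex (inner x y) (inner x (\<i> *\<^sub>C y))"
  by (simp add: complex_eq_iff inner_eq_Re_cinner cinner_scaleC_right)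

lemma norm_scaleC [simp]: "norm (c *\<^sub>C (x::'a::complex_inner)) = cmod c * norm x"
proof -
  have "(norm (c *\<^sub>C x))\<^sup>2 = Re (cnj c * c * cinner x x)"
    by (simp add: power2_norm_eq_inner inner_eq_Re_cinner cinner_scaleC_left
        cinner_scaleC_right mult.assoc)
  also have "cnj c * c = complex_of_real ((cmod c)\<^sup>2)"
    by (metis complex_norm_square mult.commute)
  also have "Re (complex_of_real ((cmod c)\<^sup>2) * cinner x x) = (cmod c * norm x)\<^sup>2"
    by (simp add: power_mult_distrib power2_norm_eq_inner inner_eq_Re_cinner)
  finally show ?thesis by (simp add: power2_eq_iff_nonneg)
qed

lemma bounded_clinearD:
  assumes "bounded_clinear A"
  shows "bounded_linear A" "A (x + y) = A x + A y" "A (x - y) = A x - A y" "A 0 = 0"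
    "A (c *\<^sub>C x) = c *\<^sub>C A x"
proof -
  show b: "bounded_linear A" using assms by (simp add: bounded_clinear_def)
  interpret bounded_linear A by fact
  show "A (x + y) = A x + A y" "A (x - y) = A x - A y" "A 0 = 0" by (simp_all add: add diff)
  show "A (c *\<^sub>C x) = c *\<^sub>C A x" using assms by (simp add: bounded_clinear_def)
qed

lemma bounded_clinear_diff:
  "bounded_clinear A \<Longrightarrow> bounded_clinear B \<Longrightarrow> bounded_clinear (\<lambda>x. A x - B x)"
  by (auto simp: bounded_clinear_def bounded_linear_sub scaleC_diff_right)

lemma bounded_clinear_comp:
  "bounded_clinear A \<Longrightarrow> bounded_clinear B \<Longrightarrow> bounded_clinear (A \<circ> B)"
  by (auto simp: bounded_clinear_def o_def bounded_linear_compose)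

lemma bounded_clinear_scaleC: "bounded_clinear (\<lambda>x. c *\<^sub>C x)"
  unfolding bounded_clinear_def
proof (intro conjI allI)
  show "bounded_linear ((*\<^sub>C) c :: 'a \<Rightarrow> 'a)"
    by (rule bounded_linear_intro[where K = "cmod c"])
       (simp_all add: scaleC_add_right scaleR_scaleC scaleC_scaleC mult.commute)
qed (simp add: scaleC_scaleC mult.commute)

text \<open>The imaginary part of \<open>cinner x y\<close> is the real inner product of
  \<open>x\<close> with \<open>\<i> *\<^sub>C y\<close>. Complex linearity thus lifts real symmetry
  to complex symmetry, and the later arguments can work with \<open>inner\<close> alone.\<close>

lemma selfadjoint_iff_inner:
  "selfadjoint A \<longleftrightarrow> bounded_clinear A \<and> (\<forall>x y. inner (A x) y = inner x (A y))"
proof -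
  have "cinner (A x) y = cinner x (A y)"
    if "bounded_clinear A" "\<forall>x y. inner (A x) y = inner x (A y)" for x y
    using that(2) bounded_clinearD(5)[OF that(1)] by (metis cinner_conv_inner)
  then show ?thesis
    unfolding selfadjoint_def by (metis inner_eq_Re_cinner)
qed

lemma selfadjointD:
  assumes "selfadjoint A"
  shows "bounded_clinear A" "inner (A x) y = inner x (A y)"
  using assms by (auto simp: selfadjoint_iff_inner)

lemma selfadjoint_diff:
  "selfadjoint A \<Longrightarrow> selfadjoint B \<Longrightarrow> selfadjoint (\<lambda>x. A x - B x)"
  by (simp add: selfadjoint_iff_inner bounded_clinear_diff inner_diff_left inner_diff_right)

text \<open>Polarization with \<open>x + y\<close> and \<open>x + \<i>y\<close>; this needs complex scalars.\<close>

lemma positive_op_selfadjoint: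
  assumes "positive_op A"
  shows "selfadjoint A"
proof -
  have A: "bounded_clinear A" using assms by (simp add: positive_op_def)
  note A_simps = bounded_clinearD(2,5)[OF A]
  have im: "Im (cinner (A x) x) = 0" for x
    using assms by (auto simp: positive_op_def complex_nonneg_Reals_iff)
  have "cinner (A x) y = cinner x (A y)" for x y
  proof -
    have "Im (cinner (A x) y) + Im (cinner (A y) x) = 0"
      using im[of "x + y"] im[of x] im[of y]
      by (simp add: A_simps cinner_add_left cinner_add_right)
    moreover have "Re (cinner (A y) x) - Re (cinner (A x) y) = 0"
      using im[of "x + \<i> *\<^sub>C y"] im[of x] im[of y]
      by (simp add: A_simps cinner_add_left cinner_add_right cinner_scaleC_left
          cinner_scaleC_right)
    ultimately have "cinner (A x) y = cnj (cinner (A y) x)"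
      by (simp add: complex_eq_iff)
    then show ?thesis by (metis cinner_commute)
  qed
  with A show ?thesis by (simp add: selfadjoint_def)
qed

section \<open>Moore-Penrose inverse\<close>

text \<open>\<open>A X\<close> and \<open>A Y\<close> are both the orthogonal projection onto the
  range of \<open>A\<close>, so they agree; likewise \<open>X A = Y A\<close>. Then
  \<open>X = X A X = X A Y = Y A Y = Y\<close>.\<close>

lemma moore_penrose_unique:
  assumes X: "is_moore_penrose A X" and Y: "is_moore_penrose A Y"
  shows "X = Y"
proof -
  have X': "A (X (A z)) = A z" "X (A (X z)) = X z"
    "inner (A (X z)) w = inner z (A (X w))" "inner (X (A z)) w = inner z (X (A w))" for z w
    using X by (auto simp: is_moore_penrose_def fun_eq_iff selfadjoint_iff_inner)
  have Y': "A (Y (A z)) = A z" "Y (A (Y z)) = Y z"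
    "inner (A (Y z)) w = inner z (A (Y w))" "inner (Y (A z)) w = inner z (Y (A w))" for z w
    using Y by (auto simp: is_moore_penrose_def fun_eq_iff selfadjoint_iff_inner)
  have "inner (A (X z)) w = inner (A (Y z)) w" for z w
  proof -
    have "inner (A (X z)) w = inner (A (Y (A (X z)))) w" by (simp add: Y')
    also have "\<dots> = inner z (A (X (A (Y w))))" by (simp add: X'(3) Y'(3))
    also have "\<dots> = inner (A (Y z)) w" by (simp add: X'(1) Y'(3))
    finally show ?thesis .
  qed
  then have AX: "A (X z) = A (Y z)" for z using vector_eq_rdot by blast
  have "inner (X (A z)) w = inner (Y (A z)) w" for z w
  proof -
    have "inner (X (A z)) w = inner (X (A (Y (A z)))) w" by (simp add: Y')
    also have "\<dots> = inner z (Y (A (X (A w))))" by (simp add: X'(4) Y'(4))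
    also have "\<dots> = inner (Y (A z)) w" by (simp add: X'(1) Y'(4))
    finally show ?thesis .
  qed
  then have XA: "X (A z) = Y (A z)" for z using vector_eq_rdot by blast
  show ?thesis by (metis AX XA X'(2) Y'(2) ext)
qed

lemma moore_penrose_eqI: "is_moore_penrose A X \<Longrightarrow> moore_penrose A = X"
  unfolding moore_penrose_def by (rule the_equality) (auto intro: moore_penrose_unique)

text \<open>The candidate \<open>X x\<close> is the unique \<open>y\<close> in the range of \<open>A\<close> with \<open>A\<^sup>2 y = A x\<close>. It is
  symmetric by construction, so Hellinger--Toeplitz supplies its boundedness.\<close>

lemma selfadjoint_moore_penrose_exists:
  fixes A :: "'a::chilbert_space \<Rightarrow> 'a"
  assumes A: "selfadjoint A" and cl: "closed (range A)"
  shows "\<exists>X. is_moore_penrose A X \<and> selfadjoint X \<and> (\<forall>x. A (X x) = X (A x))"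
proof -
  note cA = selfadjointD(1)[OF A] and sym = selfadjointD(2)[OF A]
  note A_simps = bounded_clinearD(2-5)[OF cA]
  have lin: "linear A" using bounded_clinearD(1)[OF cA] by (rule bounded_linear.linear)
  have sub: "subspace (range A)"
    using lin by (rule linear_subspace_image) simp
  have sq_cancel: "A x = 0" if "A (A x) = 0" for x
    using that sym[of x "A x"] by simp
  have ex: "\<exists>y\<in>range A. A (A y) = A x" for x
  proof -
    \<comment> \<open>With \<open>A u\<close> the projection of \<open>x\<close> onto the range, the
      residual is orthogonal to the range and so lies in the kernel of \<open>A\<close>.\<close>
    have "\<exists>u. A (A u) = A x" for x
    proof -
      obtain u where u: "\<And>w. inner (x - A u) (A w) = 0"
        using orthogonal_projection_exists[OF sub cl, of x] by blast
      have "inner (A (x - A u)) (A (x - A u)) = 0"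
        using u[of "A (x - A u)"] by (simp add: sym)
      then show ?thesis by (auto simp: A_simps)
    qed
    \<comment> \<open>The second application trades the solution \<open>u\<close> for
      \<open>A v\<close>, which lies in the range of \<open>A\<close>.\<close>
    then obtain u v where "A (A u) = A x" "A (A v) = A u" by metis
    then show ?thesis by (intro bexI[of _ "A v"]) auto
  qed
  have uniq: "y = y'" if y: "y \<in> range A" "y' \<in> range A" and eq: "A (A y) = A (A y')" for y y'
  proof -
    obtain u u' where u: "y = A u" "y' = A u'" using y by blast
    have "A (A (A (u - u'))) = 0" using eq by (simp add: u A_simps)
    then have "A (u - u') = 0" using sq_cancel by blast
    then show ?thesis by (simp add: u A_simps)
  qed
  obtain X where XR: "\<And>x. X x \<in> range A" and AAX: "\<And>x. A (A (X x)) = A x"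
    using ex by metis
  have X_eqI: "X x = y" if "y \<in> range A" "A (A y) = A x" for x y
    using uniq[OF XR that(1)] that(2) by (simp add: AAX)
  have addX: "X (x + y) = X x + X y" for x y
    by (intro X_eqI subspace_add sub XR) (simp add: A_simps AAX)
  have rangeC: "c *\<^sub>C y \<in> range A" if "y \<in> range A" for c y
    using that by (metis A_simps(4) imageE rangeI)
  have scaleX: "X (c *\<^sub>C x) = c *\<^sub>C X x" for c x
    by (intro X_eqI rangeC XR) (simp add: A_simps AAX)
  have linX: "linear X"
    by (rule linearI) (simp_all add: addX scaleX scaleR_scaleC)
  have symX: "inner (X x) y = inner x (X y)" for x y
  proof -
    \<comment> \<open>The right side is symmetric in \<open>x\<close> and \<open>y\<close> because
      \<open>A\<close> is, so the left side is too.\<close>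
    have half: "inner (X x) y = inner (A (X x)) (X y)" for x y
    proof -
      obtain w where w: "X x = A w" using XR by blast
      have "inner (X x) y = inner w (A (A (X y)))" by (simp add: w sym AAX)
      then show ?thesis by (simp add: w sym)
    qed
    show ?thesis using half[of x y] half[of y x] sym[of "X y" "X x"] by (metis inner_commute)
  qed
  have saX: "selfadjoint X"
    using Hellinger_Toeplitz[OF linX symX] symX scaleX
    by (auto simp: selfadjoint_iff_inner bounded_clinear_def)
  have comm: "A (X x) = X (A x)" for x
    using X_eqI[of "A (X x)" "A x"] by (simp add: AAX)
  have XAX: "X (A (X x)) = X x" for x
    by (intro X_eqI XR) simp
  have XAA: "X (A (A x)) = A x" for x
    by (intro X_eqI) simp_all
  have AX: "A \<circ> X = X \<circ> A" by (simp add: fun_eq_iff comm)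
  have "selfadjoint (X \<circ> A)"
    using selfadjointD(1)[OF saX] cA
    by (simp add: selfadjoint_iff_inner bounded_clinear_comp sym symX comm)
  then have "is_moore_penrose A X"
    unfolding is_moore_penrose_def AX using selfadjointD(1)[OF saX]
    by (simp add: fun_eq_iff XAA XAX)
  then show ?thesis using saX comm by blast
qed

section \<open>Spectral radius of a selfadjoint operator\<close>

text \<open>Puts a point outside the spectrum: the lower bound gives both injectivity and the bound
  \<open>inverse c\<close> for the inverse.\<close>

lemma inverse_if_bounded_below_surj:
  fixes A :: "'a::chilbert_space \<Rightarrow> 'a"
  assumes A: "bounded_clinear A" and c: "c > 0" and below: "\<And>x. c * norm x \<le> norm (A x)"
    and surj: "surj A"
  shows "\<exists>B. bounded_clinear B \<and> B \<circ> A = id \<and> A \<circ> B = id"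
proof -
  note A_simps = bounded_clinearD(2-5)[OF A]
  have inj: "x = y" if "A x = A y" for x y
  proof -
    have "c * norm (x - y) \<le> 0" using below[of "x - y"] that by (simp add: A_simps)
    then show ?thesis using c by (simp add: mult_le_0_iff)
  qed
  obtain B where AB: "\<And>x. A (B x) = x" using surj by (metis surj_def)
  have BA: "B (A x) = x" for x by (rule inj) (simp add: AB)
  have Badd: "B (x + y) = B x + B y" for x y by (rule inj) (simp add: A_simps AB)
  have Bscale: "B (k *\<^sub>C x) = k *\<^sub>C B x" for k x by (rule inj) (simp add: A_simps AB)
  have "norm (B x) \<le> norm x * inverse c" for x
    using below[of "B x"] c by (simp add: AB field_simps)
  then have "bounded_linear B"
    by (intro bounded_linear_intro[where K = "inverse c"]) (simp_all add: Badd Bscale scaleR_scaleC)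
  then show ?thesis
    using AB BA Bscale by (intro exI[of _ B]) (auto simp: bounded_clinear_def)
qed

text \<open>Surjectivity of \<open>A - z\<close> comes from the contraction \<open>x \<mapsto> (A x - y) / z\<close>.\<close>

lemma norm_spectrum_le_onorm:
  fixes A :: "'a::chilbert_space \<Rightarrow> 'a"
  assumes A: "bounded_clinear A" and z: "z \<in> spectrum A"
  shows "cmod z \<le> onorm A"
proof (rule ccontr)
  assume "\<not> ?thesis"
  then have lt: "onorm A < cmod z" by simp
  note bl = bounded_clinearD(1)[OF A]
  have z0: "cmod z > 0" "z \<noteq> 0" using lt onorm_pos_le[OF bl] by auto
  let ?R = "\<lambda>x. A x - z *\<^sub>C x"
  have R: "bounded_clinear ?R" by (intro bounded_clinear_diff A bounded_clinear_scaleC)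
  have below: "(cmod z - onorm A) * norm x \<le> norm (?R x)" for x
    using onorm[OF bl, of x] norm_triangle_ineq2[of "z *\<^sub>C x" "A x"]
    by (simp add: norm_minus_commute algebra_simps)
  have "\<exists>x. ?R x = y" for y
  proof -
    let ?f = "\<lambda>x. inverse z *\<^sub>C (A x - y)"
    have "dist (?f x) (?f x') \<le> (onorm A / cmod z) * dist x x'" for x x'
    proof -
      have "?f x - ?f x' = inverse z *\<^sub>C A (x - x')"
        by (simp flip: scaleC_diff_right add: bounded_clinearD[OF A])
      then have "dist (?f x) (?f x') = norm (A (x - x')) / cmod z"
        by (simp add: dist_norm norm_inverse divide_inverse)
      also have "\<dots> \<le> onorm A * norm (x - x') / cmod z"
        using onorm[OF bl] z0 by (simp add: divide_right_mono)
      finally show ?thesis by (simp add: dist_norm)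
    qed
    then have "\<exists>!x. ?f x = x"
      using lt z0 onorm_pos_le[OF bl]
      by (intro banach_fix_type[of "onorm A / cmod z"]) auto
    then obtain x where "?f x = x" by blast
    then have "z *\<^sub>C x = z *\<^sub>C ?f x" by simp
    also have "\<dots> = A x - y" using z0 by (simp add: scaleC_scaleC)
    finally show ?thesis by (metis diff_diff_eq2 add_diff_cancel_left')
  qed
  then have "surj ?R" unfolding surj_def by metis
  then show False
    using inverse_if_bounded_below_surj[OF R _ below] lt z by (auto simp: spectrum_def)
qed

text \<open>If neither of \<open>\<plusminus>\<parallel>A\<parallel>\<close> were in the spectrum, then \<open>A\<^sup>2 - \<parallel>A\<parallel>\<^sup>2\<close> would be bounded below; but
  \<open>\<parallel>A\<^sup>2x - \<parallel>A\<parallel>\<^sup>2x\<parallel>\<^sup>2 \<le> \<parallel>A\<parallel>\<^sup>2 (\<parallel>A\<parallel>\<^sup>2\<parallel>x\<parallel>\<^sup>2 - \<parallel>Ax\<parallel>\<^sup>2)\<close> by symmetry.\<close>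

lemma selfadjoint_onorm_in_spectrum:
  fixes A :: "'a::chilbert_space \<Rightarrow> 'a"
  assumes A: "selfadjoint A" and pos: "onorm A > 0"
  shows "complex_of_real (onorm A) \<in> spectrum A \<or> - complex_of_real (onorm A) \<in> spectrum A"
proof (rule ccontr)
  assume neg: "\<not> ?thesis"
  note cA = selfadjointD(1)[OF A] and sym = selfadjointD(2)[OF A]
  note bl = bounded_clinearD(1)[OF cA] and A_simps = bounded_clinearD(2-5)[OF cA]
  define a where "a = onorm A"
  have scale: "A (r *\<^sub>R x) = r *\<^sub>R A x" for r x by (simp add: A_simps scaleR_scaleC)
  have minus: "(- complex_of_real a) *\<^sub>C x = - (a *\<^sub>R x)" for x :: 'a
    by (metis of_real_minus scaleR_minus_left scaleR_scaleC)
  obtain B C where B: "bounded_clinear B" "B \<circ> (\<lambda>x. A x - complex_of_real a *\<^sub>C x) = id"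
    and C: "bounded_clinear C" "C \<circ> (\<lambda>x. A x - (- complex_of_real a) *\<^sub>C x) = id"
    using neg unfolding spectrum_def a_def by blast
  have B': "B (A x - a *\<^sub>R x) = x" for x
    using fun_cong[OF B(2), of x] by (simp add: scaleR_scaleC)
  have C': "C (A x + a *\<^sub>R x) = x" for x
    using fun_cong[OF C(2), of x] by (simp add: minus)
  have BC: "bounded_linear (C \<circ> B)"
    by (intro bounded_clinearD(1) bounded_clinear_comp B C)
  \<comment> \<open>\<open>B\<close> and \<open>C\<close> are left inverses of \<open>A - a\<close>
    and \<open>A + a\<close>, so \<open>C \<circ> B\<close> is a left inverse of the product
    \<open>A\<^sup>2 - a\<^sup>2\<close>.\<close>
  define K where "K = onorm (C \<circ> B)"
  have K: "norm x \<le> K * norm (A (A x) - a\<^sup>2 *\<^sub>R x)" for x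
  proof -
    have "A (A x + a *\<^sub>R x) - a *\<^sub>R (A x + a *\<^sub>R x) = A (A x) - a\<^sup>2 *\<^sub>R x"
      by (simp add: A_simps scale scaleR_add_right power2_eq_square)
    then have "(C \<circ> B) (A (A x) - a\<^sup>2 *\<^sub>R x) = x" using B'[of "A x + a *\<^sub>R x"] C'[of x] by simp
    then show ?thesis using onorm[OF BC, of "A (A x) - a\<^sup>2 *\<^sub>R x"] by (simp add: K_def)
  qed
  have a0: "a > 0" using pos by (simp add: a_def)
  \<comment> \<open>The summand 1 keeps \<open>L\<close> positive, so that \<open>1 / L\<close> is a
    genuine gap below \<open>a\<^sup>2\<close>.\<close>
  define L where "L = K\<^sup>2 * a\<^sup>2 + 1"
  have L: "L \<ge> 1" by (simp add: L_def)
  have gap: "(norm (A x))\<^sup>2 \<le> (a\<^sup>2 - 1 / L) * (norm x)\<^sup>2" for x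
  proof -
    have "(norm (A (A x) - a\<^sup>2 *\<^sub>R x))\<^sup>2 =
        (norm (A (A x)))\<^sup>2 - 2 * a\<^sup>2 * (norm (A x))\<^sup>2 + a^4 * (norm x)\<^sup>2"
      unfolding power2_norm_eq_inner
      by (simp add: inner_diff_left inner_diff_right sym[of "A x" x] inner_commute[of x "A (A x)"]
          power2_eq_square power4_eq_xxxx algebra_simps)
    also have "(norm (A (A x)))\<^sup>2 \<le> a\<^sup>2 * (norm (A x))\<^sup>2"
      using power_mono[OF onorm[OF bl, of "A x"], of 2] by (simp add: a_def power_mult_distrib)
    finally have "(norm (A (A x) - a\<^sup>2 *\<^sub>R x))\<^sup>2 \<le> a\<^sup>2 * (a\<^sup>2 * (norm x)\<^sup>2 - (norm (A x))\<^sup>2)"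
      by (simp add: algebra_simps power2_eq_square power4_eq_xxxx)
    moreover have "(norm x)\<^sup>2 \<le> K\<^sup>2 * (norm (A (A x) - a\<^sup>2 *\<^sub>R x))\<^sup>2"
      using power_mono[OF K, of x 2] by (simp add: power_mult_distrib)
    ultimately have "(norm x)\<^sup>2 \<le> K\<^sup>2 * (a\<^sup>2 * (a\<^sup>2 * (norm x)\<^sup>2 - (norm (A x))\<^sup>2))"
      by (meson mult_left_mono order_trans zero_le_power2)
    also have "\<dots> \<le> L * (a\<^sup>2 * (norm x)\<^sup>2 - (norm (A x))\<^sup>2)"
    proof -
      have "(norm (A x))\<^sup>2 \<le> a\<^sup>2 * (norm x)\<^sup>2"
        using power_mono[OF onorm[OF bl, of x], of 2] by (simp add: a_def power_mult_distrib)
      then show ?thesis by (simp add: L_def algebra_simps)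
    qed
    finally show ?thesis using L by (simp add: field_simps)
  qed
  \<comment> \<open>Needed before taking the square root that bounds \<open>onorm A\<close> strictly
    below itself.\<close>
  have sq0: "0 \<le> a\<^sup>2 - 1 / L"
  proof -
    obtain x where "A x \<noteq> 0" using pos onorm_pos_lt[OF bl] by auto
    then have "(norm (A x))\<^sup>2 > 0" by simp
    then have "0 < (a\<^sup>2 - 1 / L) * (norm x)\<^sup>2" using gap[of x] by linarith
    then show ?thesis by (simp add: zero_less_mult_iff)
  qed
  have "norm (A x) \<le> sqrt (a\<^sup>2 - 1 / L) * norm x" for x
    by (rule power2_le_imp_le) (use gap[of x] sq0 in \<open>auto simp: power_mult_distrib\<close>)
  then have "a \<le> sqrt (a\<^sup>2 - 1 / L)"
    using onorm_bound[of "sqrt (a\<^sup>2 - 1 / L)" A] sq0 by (simp flip: a_def)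
  then have "a\<^sup>2 \<le> a\<^sup>2 - 1 / L"
    using sq0 a0 by (metis less_imp_le real_le_rsqrt real_sqrt_le_iff real_sqrt_pow2 power_mono)
  then show False using L by simp
qed

text \<open>The spectrum lies in the disc of radius \<open>onorm A\<close>, and a positive
  \<open>onorm A\<close> is attained at one of its two real boundary points. If the norm is 0, the
  inserted 0 attains the supremum.\<close>

theorem spectral_radius_selfadjoint:
  fixes A :: "'a::chilbert_space \<Rightarrow> 'a"
  assumes A: "selfadjoint A"
  shows "spectral_radius A = onorm A"
proof -
  note cA = selfadjointD(1)[OF A]
  note bl = bounded_clinearD(1)[OF cA]
  have "onorm A \<in> insert 0 (cmod ` spectrum A)"
  proof (cases "onorm A = 0")
    case False
    then have pos: "onorm A > 0" using onorm_pos_le[OF bl] by simp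
    obtain z where "z \<in> spectrum A" "cmod z = onorm A"
      using selfadjoint_onorm_in_spectrum[OF A pos] pos
      by (metis norm_minus_cancel norm_of_real abs_of_pos)
    then show ?thesis by force
  qed simp
  then show ?thesis
    unfolding spectral_radius_def
    using norm_spectrum_le_onorm[OF cA] onorm_pos_le[OF bl] by (intro cSup_eq_maximum) auto
qed

section \<open>Positive orthogonal decompositions\<close>

text \<open>The products vanish because the squared norm of \<open>A1 (A2 x)\<close> equals the
  inner product of \<open>A2 x\<close> with \<open>A1 (A1 (A2 x))\<close>, and the ranges are
  orthogonal.\<close>

lemma is_pos_orth_decompD:
  fixes A A1 A2 :: "'a::chilbert_space \<Rightarrow> 'a"
  assumes "is_pos_orth_decomp A A1 A2"
  shows "selfadjoint A1" "selfadjoint A2" "A x = A1 x - A2 x" "A1 (A2 x) = 0" "A2 (A1 x) = 0"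
proof -
  show s1: "selfadjoint A1" and s2: "selfadjoint A2"
    using assms by (simp_all add: is_pos_orth_decomp_def positive_op_selfadjoint)
  show "A x = A1 x - A2 x" using assms by (simp add: is_pos_orth_decomp_def)
  have orth: "inner (A1 u) (A2 v) = 0" for u v
    using assms closure_subset[of "range A1"] closure_subset[of "range A2"]
    by (auto simp: is_pos_orth_decomp_def inner_eq_Re_cinner subset_iff)
  show "A1 (A2 x) = 0"
    using orth[of "A1 (A2 x)" x] selfadjointD(2)[OF s1, of "A2 x" "A1 (A2 x)"]
    by (simp add: inner_commute)
  show "A2 (A1 x) = 0"
    using orth[of x "A2 (A1 x)"] selfadjointD(2)[OF s2, of "A1 x" "A2 (A1 x)"] by simp
qed

text \<open>A limit point \<open>y\<close> of the range of \<open>A1\<close> lies in the closed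
  range of \<open>A\<close>, say \<open>y + 0 = A x\<close>. Comparing orthogonal components with
  \<open>A x = A1 x - A2 x\<close> yields \<open>y = A1 x\<close>; the other range is treated
  alike.\<close>

lemma is_pos_orth_decomp_closed:
  fixes A A1 A2 :: "'a::chilbert_space \<Rightarrow> 'a"
  assumes d: "is_pos_orth_decomp A A1 A2" and cl: "closed (range A)"
  shows "closed (range A1)" "closed (range A2)"
proof -
  let ?C1 = "closure (range A1)" and ?C2 = "closure (range A2)"
  note D = is_pos_orth_decompD[OF d]
  have orth: "inner y z = 0" if "y \<in> ?C1" "z \<in> ?C2" for y z
    using d that by (simp add: is_pos_orth_decomp_def inner_eq_Re_cinner)
  have sum: "y + z \<in> range A" if "y \<in> ?C1" "z \<in> ?C2" for y z
  proof -
    have "{x + y | x y. x \<in> ?C1 \<and> y \<in> ?C2} = range A"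
      using d closure_closed[OF cl] by (simp only: is_pos_orth_decomp_def)
    then show ?thesis using that by blast
  qed
  have in1: "A1 x \<in> ?C1" and in2: "A2 x \<in> ?C2" for x
    by (rule subsetD[OF closure_subset rangeI])+
  have zero: "0 \<in> ?C1" "0 \<in> ?C2"
    using in1[of 0] in2[of 0] D(1,2)[THEN selfadjointD(1), THEN bounded_clinearD(4)] by simp_all
  have split: "y = A1 x \<and> z = - A2 x"
    if y: "y \<in> ?C1" and z: "z \<in> ?C2" and eq: "y + z = A x" for x y z
  proof -
    \<comment> \<open>The two sides are orthogonal up to sign and equal, hence both vanish.\<close>
    have e: "y - A1 x = - (z + A2 x)" using eq D(3)[of x] by (simp add: algebra_simps)
    have "inner (y - A1 x) (z + A2 x) = 0"
      using orth y z in1 in2 by (simp add: inner_diff_left inner_add_right)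
    then have "z + A2 x = 0"
      by (simp only: e inner_minus_left neg_equal_0_iff_equal inner_eq_zero_iff)
    then show ?thesis using e by (simp add: eq_neg_iff_add_eq_0)
  qed
  have "y \<in> range A1" if "y \<in> ?C1" for y
    using sum[OF that, of 0] split[OF that, of 0] zero by auto
  then show "closed (range A1)" by (metis closure_subset closure_eq subsetI subset_antisym)
  have "z \<in> range A2" if z: "z \<in> ?C2" for z
  proof -
    obtain x where "0 + z = A x" using sum[OF zero(1) z] by blast
    then have "z = - A2 x" using split[OF zero(1) z] by blast
    then have "z = A2 (- x)"
      using bounded_clinearD(3)[OF selfadjointD(1)[OF D(2)], of 0 x]
        bounded_clinearD(4)[OF selfadjointD(1)[OF D(2)]] by simp
    then show ?thesis by blast
  qed
  then show "closed (range A2)" by (metis closure_subset closure_eq subsetI subset_antisym)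
qed

section \<open>Block structure of \<open>U\<^sup>\<dagger>V\<close> and its norm\<close>

theorem theorem4p4:
  fixes T T1 T2 U U1 U2 V :: "'a::chilbert_space \<Rightarrow> 'a"
  assumes "selfadjoint T" and "closed (range T)"
    and "is_pos_orth_decomp T T1 T2"
    and "proper_splitting T U V"
    and "selfadjoint U"
    and "is_pos_orth_decomp U U1 U2"
    and "range U1 = range T1" and "range U2 = range T2"
    and "selfadjoint (moore_penrose U \<circ> T)"
  shows "splitting_converges U V \<longleftrightarrow>
    spectral_radius (moore_penrose U \<circ> V) =
      max (onorm (moore_penrose U1 \<circ> V)) (onorm (moore_penrose U2 \<circ> V)) \<and>
    max (onorm (moore_penrose U1 \<circ> V)) (onorm (moore_penrose U2 \<circ> V)) < 1"
proof -
  note DT = is_pos_orth_decompD[OF assms(3)] and DU = is_pos_orth_decompD[OF assms(6)]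
  have cV: "bounded_clinear V" and V: "V x = U x - T x" and clU: "closed (range U)" for x
    using assms(2,4) by (auto simp: proper_splitting_def fun_eq_iff)
  obtain X1 where mp1: "is_moore_penrose U1 X1" and sa1: "selfadjoint X1"
    and comm1: "\<And>x. U1 (X1 x) = X1 (U1 x)"
    using selfadjoint_moore_penrose_exists[OF DU(1)] is_pos_orth_decomp_closed[OF assms(6) clU]
    by blast
  obtain X2 where mp2: "is_moore_penrose U2 X2" and sa2: "selfadjoint X2"
    and comm2: "\<And>x. U2 (X2 x) = X2 (U2 x)"
    using selfadjoint_moore_penrose_exists[OF DU(2)] is_pos_orth_decomp_closed[OF assms(6) clU]
    by blast
  have c: "bounded_clinear U1" "bounded_clinear U2" "bounded_clinear X1" "bounded_clinear X2"
    "bounded_clinear T1" "bounded_clinear T2"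
    using DU(1,2) DT(1,2) sa1 sa2 by (auto dest: selfadjointD)
  note c_simps = c[THEN bounded_clinearD(2)] c[THEN bounded_clinearD(3)] c[THEN bounded_clinearD(4)]
  note sym = selfadjointD(2)[OF DU(1)] selfadjointD(2)[OF DU(2)]
    selfadjointD(2)[OF sa1] selfadjointD(2)[OF sa2]
  have pen1: "U1 (X1 (U1 x)) = U1 x" "X1 (U1 (X1 x)) = X1 x" for x
    using mp1 by (auto simp: is_moore_penrose_def fun_eq_iff)
  have pen2: "U2 (X2 (U2 x)) = U2 x" "X2 (U2 (X2 x)) = X2 x" for x
    using mp2 by (auto simp: is_moore_penrose_def fun_eq_iff)
  have pen1': "X1 (U1 (U1 x)) = U1 x" "X1 (X1 (U1 x)) = X1 x" for x
    using pen1 comm1 by metis+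
  have pen2': "X2 (U2 (U2 x)) = U2 x" "X2 (X2 (U2 x)) = X2 x" for x
    using pen2 comm2 by metis+
  have X1_0: "X1 z = 0" if "U1 z = 0" for z
    using pen1(2)[of z] that by (simp add: comm1 c_simps)
  have X2_0: "X2 z = 0" if "U2 z = 0" for z
    using pen2(2)[of z] that by (simp add: comm2 c_simps)
  \<comment> \<open>\<open>X2 x = U2 (X2 (X2 x))\<close> lies in the range of \<open>U2\<close>,
    which \<open>U1\<close> annihilates.\<close>
  have U1X2: "U1 (X2 x) = 0" and U2X1: "U2 (X1 x) = 0" for x
    using pen1(2)[of x] pen2(2)[of x] by (metis DU(4) comm2) (metis DU(5) comm1 pen1(2))
  note cross = DU(4,5) U1X2 U2X1 X1_0[OF DU(4)] X2_0[OF DU(5)] X1_0[OF U1X2] X2_0[OF U2X1]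
  \<comment> \<open>Here the equality of ranges enters: \<open>T2 x\<close> is a value of
    \<open>U2\<close>, and \<open>X1\<close> kills those.\<close>
  have X1T2: "X1 (T2 x) = 0" and X2T1: "X2 (T1 x) = 0" for x
    using assms(7,8) cross(5,6) by (metis rangeE rangeI)+

  define X where "X x = X1 x - X2 x" for x
  have cX: "bounded_clinear X"
    unfolding X_def by (intro bounded_clinear_diff c)
  have UX: "U \<circ> X = X \<circ> U"
    by (simp add: fun_eq_iff X_def DU(3) c_simps cross comm1 comm2)
  \<comment> \<open>With the mixed terms gone, \<open>X \<circ> U\<close> is the sum of the
    projections \<open>X1 U1\<close> and \<open>X2 U2\<close>.\<close>
  have "inner ((X \<circ> U) x) y = inner x ((X \<circ> U) y)" for x y
    by (simp add: X_def DU(3) c_simps cross inner_add_left inner_add_right sym comm1 comm2)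
  then have saXU: "selfadjoint (X \<circ> U)"
    using cX selfadjointD(1)[OF assms(5)] by (simp add: selfadjoint_iff_inner bounded_clinear_comp)
  have "is_moore_penrose U X"
    unfolding is_moore_penrose_def UX using cX saXU
    by (simp add: fun_eq_iff X_def DU(3) c_simps cross pen1' pen2' comm1 comm2)
  then have mpU: "moore_penrose U = X" by (rule moore_penrose_eqI)

  define W where "W = moore_penrose U \<circ> V"
  define F1 where "F1 = X1 \<circ> V"
  define F2 where "F2 = X2 \<circ> V"
  have F: "bounded_clinear F1" "bounded_clinear F2"
    unfolding F1_def F2_def by (intro bounded_clinear_comp c cV)+
  note F_bl = F[THEN bounded_clinearD(1)] and F_diff = F[THEN bounded_clinearD(3)]
  have W_eq: "W x = F1 x - F2 x" for x by (simp add: W_def F1_def F2_def mpU X_def)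
  have "W = (\<lambda>x. (moore_penrose U \<circ> U) x - (moore_penrose U \<circ> T) x)"
    by (simp add: W_def fun_eq_iff mpU V bounded_clinearD(3)[OF cX])
  moreover have "selfadjoint (moore_penrose U \<circ> U)" by (simp add: mpU saXU)
  ultimately have saW: "selfadjoint W" using selfadjoint_diff assms(9) by metis
  note W_bl = saW[THEN selfadjointD(1), THEN bounded_clinearD(1)]

  have "onorm W = max (onorm F1) (onorm F2)"
  proof (rule antisym)
    \<comment> \<open>Pythagoras: \<open>X1 X2 = 0\<close> makes the values of \<open>F1\<close> and
      \<open>F2\<close> orthogonal.\<close>
    have normW: "(norm (W x))\<^sup>2 = (norm (F1 x))\<^sup>2 + (norm (F2 x))\<^sup>2" for x
    proof -
      have "inner (F1 x) (F2 x) = 0" by (simp add: F1_def F2_def sym cross)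
      then show ?thesis
        unfolding power2_norm_eq_inner
        by (simp add: W_eq inner_diff_left inner_diff_right inner_commute[of "F2 x" "F1 x"])
    qed
    have "norm (F1 x) \<le> norm (W x)" "norm (F2 x) \<le> norm (W x)" for x
      by (rule power2_le_imp_le; simp add: normW)+
    then have "norm (F1 x) \<le> onorm W * norm x" "norm (F2 x) \<le> onorm W * norm x" for x
      using onorm[OF W_bl] order_trans by blast+
    then show "max (onorm F1) (onorm F2) \<le> onorm W"
      using onorm_pos_le[OF W_bl] by (simp add: onorm_bound)

    define m where "m = max (onorm F1) (onorm F2)"
    have m0: "m \<ge> 0" using onorm_pos_le[OF F_bl(1)] by (simp add: m_def)
    \<comment> \<open>The kernel of a selfadjoint operator is the orthogonal complement of its
      range, and the ranges of \<open>T1\<close> and \<open>U1\<close> agree.\<close>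
    have T1_0: "T1 z = 0" if "U1 z = 0" for z
    proof -
      obtain w where "T1 (T1 z) = U1 w" using assms(7) by (metis rangeE rangeI)
      then have "inner (T1 z) (T1 z) = inner z (U1 w)" by (simp add: selfadjointD(2)[OF DT(1)])
      then show ?thesis by (simp add: that flip: sym(1))
    qed
    have T2_0: "T2 z = 0" if "U2 z = 0" for z
    proof -
      obtain w where "T2 (T2 z) = U2 w" using assms(8) by (metis rangeE rangeI)
      then have "inner (T2 z) (T2 z) = inner z (U2 w)" by (simp add: selfadjointD(2)[OF DT(2)])
      then show ?thesis by (simp add: that flip: sym(2))
    qed
    \<comment> \<open>\<open>P1\<close> and \<open>P2\<close> project orthogonally onto the ranges
      of \<open>U1\<close> and \<open>U2\<close>. Each block sees only its own component of
      \<open>x\<close>, so the block bounds combine through Bessel's inequality to the maximum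
      rather than the sum.\<close>
    define P1 where "P1 x = X1 (U1 x)" for x
    define P2 where "P2 x = X2 (U2 x)" for x
    have F1P: "F1 x = F1 (P1 x)" for x
    proof -
      \<comment> \<open>\<open>x - P1 x\<close> is killed by \<open>U1\<close> and
        \<open>T1\<close>, while the \<open>U2\<close> and \<open>T2\<close> parts of
        \<open>V\<close> are killed by \<open>X1\<close>.\<close>
      have z: "U1 (x - P1 x) = 0" by (simp add: P1_def c_simps pen1)
      have "F1 (x - P1 x) = 0"
        using z T1_0[OF z] by (simp add: F1_def V DU(3) DT(3) c_simps cross X1T2)
      then show ?thesis by (simp add: F_diff)
    qed
    have F2P: "F2 x = F2 (P2 x)" for x
    proof -
      have z: "U2 (x - P2 x) = 0" by (simp add: P2_def c_simps pen2)
      have "F2 (x - P2 x) = 0"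
        using z T2_0[OF z] by (simp add: F2_def V DU(3) DT(3) c_simps cross X2T1)
      then show ?thesis by (simp add: F_diff)
    qed
    have Bessel: "(norm (P1 x))\<^sup>2 + (norm (P2 x))\<^sup>2 \<le> (norm x)\<^sup>2" for x
    proof -
      have "inner x (P1 x) = (norm (P1 x))\<^sup>2" "inner x (P2 x) = (norm (P2 x))\<^sup>2"
        "inner (P1 x) (P2 x) = 0"
        unfolding P1_def P2_def power2_norm_eq_inner
        by (simp_all add: sym cross comm1 comm2 pen1' pen2' c_simps)
      moreover have "0 \<le> (norm (x - P1 x - P2 x))\<^sup>2" by simp
      ultimately show ?thesis
        unfolding power2_norm_eq_inner
        by (simp add: inner_diff_left inner_diff_right inner_commute[of "P1 x" x]
            inner_commute[of "P2 x" x] inner_commute[of "P2 x" "P1 x"])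
    qed
    have "norm (W x) \<le> m * norm x" for x
    proof (rule power2_le_imp_le)
      have "norm (F1 (P1 x)) \<le> m * norm (P1 x)" "norm (F2 (P2 x)) \<le> m * norm (P2 x)"
        by (rule order_trans[OF onorm[OF F_bl(1)]], simp add: m_def mult_right_mono,
            rule order_trans[OF onorm[OF F_bl(2)]], simp add: m_def mult_right_mono)
      then have "(norm (F1 x))\<^sup>2 \<le> (m * norm (P1 x))\<^sup>2" "(norm (F2 x))\<^sup>2 \<le> (m * norm (P2 x))\<^sup>2"
        using F1P[of x] F2P[of x] by (auto intro: power_mono)
      then have "(norm (W x))\<^sup>2 \<le> m\<^sup>2 * ((norm (P1 x))\<^sup>2 + (norm (P2 x))\<^sup>2)"
        by (simp add: normW power_mult_distrib distrib_left)
      also have "\<dots> \<le> m\<^sup>2 * (norm x)\<^sup>2" by (intro mult_left_mono Bessel) simp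
      finally show "(norm (W x))\<^sup>2 \<le> (m * norm x)\<^sup>2" by (simp add: power_mult_distrib)
    qed (simp add: m0)
    then show "onorm W \<le> max (onorm F1) (onorm F2)"
      unfolding m_def[symmetric] by (rule onorm_bound[OF m0])
  qed
  then have "spectral_radius W = max (onorm F1) (onorm F2)"
    by (simp add: spectral_radius_selfadjoint saW)
  then show ?thesis
    using moore_penrose_eqI[OF mp1] moore_penrose_eqI[OF mp2]
    by (auto simp: splitting_converges_def W_def F1_def F2_def)
qed

end
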